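(* Consider a VRPSD instance under the optimal restocking (OR) policy. Then the superadditivity property holds for the OR recourse: $\mathcal{Q}^{\text{OR}}_{(p_1,p_2)}\ge\mathcal{Q}^{\text{OR}}_{p_1}+\mathcal{Q}^{\text{OR}}_{p_2}$ for all $p_1,p_2\in\mathcal{P}$ such that the concatenation $(p_1,p_2)\in\mathcal{P}$.
   Context: Let $N=\{1,\dots,n\}$ be customers, $0$ the depot, with symmetric non-negative travel costs $c_{i,j}$ on $\{0\}\cup N$ satisfying the triangle inequality ($c_{i,i}=0$). Demands $\xi_i$, $i\in N$, are independent random variables with supports $\Xi_i\subseteq\mathbb{Z}_{\ge0}$, probabilities $\rho_i^s=\mathbb{P}[\xi_i=s]$ and finite means $\mu_i$; the vehicle capacity $Q$ is a positive integer; $f>0$ is the load factor, with $\max_i\mu_i\le fQ$. Penalties satisfy $0\le b^P\le b^F$. Failure cost: $c^F_i=b^F+2c_{0,i}$. Preventive return cost: $c^P_{i,j}=b^P+c_{0,i}+c_{0,j}-c_{i,j}$ (the same formula is used when $i=0$, giving $c^P_{0,j}=b^P$). A path is a nonempty sequence $p=(i_1,\dots,i_t)$ of distinct customers, $N(p)$ its set of customers, and $\mathcal{P}=\{p:\sum_{i\in N(p)}\mu_i\le fQ\}$. For paths with disjoint customer sets, $(p_1,p_2)$ is their concatenation. OR expected recourse: let $\Psi(s,q)=\max\{\lceil(s-q)/Q\rceil,0\}$. For the route $(0,p,0)=(i_0,i_1,\dots,i_t,i_{t+1})$ define, for $q\in\{0,\dots,Q\}$, $F^p_{i_t}(q)=0$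 and for $j=t-1,\dots,0$, $$F^p_{i_j}(q)=\min\left\{H^p_{i_{j+1}}(q),\;c^P_{i_j,i_{j+1}}+H^p_{i_{j+1}}(Q)\right\},$$ $$H^p_{i_{j+1}}(q)=\sum_{s\in\Xi_{i_{j+1}}}\left[c^F_{i_{j+1}}\Psi(s,q)+F^p_{i_{j+1}}\big(\Psi(s,q)Q+q-s\big)\right]\rho^s_{i_{j+1}}.$$ Set $\bar{\mathcal{Q}}^{\text{OR}}_p=F^p_{i_0}(Q)$ and $\mathcal{Q}^{\text{OR}}_p=\min\{\bar{\mathcal{Q}}^{\text{OR}}_{(i_1,\dots,i_t)},\bar{\mathcal{Q}}^{\text{OR}}_{(i_t,\dots,i_1)}\}$. *)

theory Defs
  imports "HOL-Probability.Probability"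
begin

text \<open>
  An instance of the vehicle routing problem with stochastic demands. Node 0 is the depot, the
  customers are 1, ..., n. Demands are natural-number-valued random variables on a common
  probability space; only the nodes 0, ..., n are constrained by the locale below.
\<close>

record 'w vrpsd_data =
  n_customers :: nat
  cost :: "nat \<Rightarrow> nat \<Rightarrow> real"
  prob_model :: "'w measure"
  demand :: "nat \<Rightarrow> 'w \<Rightarrow> nat"
  capacity :: int
  load_factor :: real
  penalty_P :: real
  penalty_F :: real

definition customers :: "'w vrpsd_data \<Rightarrow> nat set" where
  "customers I = {1..n_customers I}"

definition nodes :: "'w vrpsd_data \<Rightarrow> nat set" where
  "nodes I = insert 0 (customers I)"

definition mean_demand :: "'w vrpsd_data \<Rightarrow> nat \<Rightarrow> real" where
  "mean_demand I i = (\<integral>\<omega>. real (demand I i \<omega>) \<partial>prob_model I)"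

definition demand_prob :: "'w vrpsd_data \<Rightarrow> nat \<Rightarrow> nat \<Rightarrow> real" where
  "demand_prob I i s = measure (prob_model I) {\<omega> \<in> space (prob_model I). demand I i \<omega> = s}"

definition demand_support :: "'w vrpsd_data \<Rightarrow> nat \<Rightarrow> nat set" where
  "demand_support I i = {s. demand_prob I i s > 0}"

locale vrpsd = prob_space "prob_model I" for I :: "'w vrpsd_data" +
  assumes cost_nonneg: "\<lbrakk>i \<in> nodes I; j \<in> nodes I\<rbrakk> \<Longrightarrow> 0 \<le> cost I i j"
    and cost_sym: "\<lbrakk>i \<in> nodes I; j \<in> nodes I\<rbrakk> \<Longrightarrow> cost I i j = cost I j i"
    and cost_refl: "i \<in> nodes I \<Longrightarrow> cost I i i = 0"
    and cost_triangle: "\<lbrakk>i \<in> nodes I; j \<in> nodes I; k \<in> nodes I\<rbrakk> \<Longrightarrow>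
          cost I i k \<le> cost I i j + cost I j k"
    and demand_indep: "indep_vars (\<lambda>_. count_space UNIV) (demand I) (customers I)"
    and demand_integrable: "i \<in> customers I \<Longrightarrow>
          integrable (prob_model I) (\<lambda>\<omega>. real (demand I i \<omega>))"
    and capacity_pos: "0 < capacity I"
    and load_factor_pos: "0 < load_factor I"
    and mean_demand_le: "i \<in> customers I \<Longrightarrow> mean_demand I i \<le> load_factor I * capacity I"
    and penalty_P_nonneg: "0 \<le> penalty_P I"
    and penalty_P_le_F: "penalty_P I \<le> penalty_F I"

definition paths :: "'w vrpsd_data \<Rightarrow> nat list set" where
  "paths I = {p. p \<noteq> [] \<and> distinct p \<and> set p \<subseteq> customers I \<and>
                 (\<Sum>i\<in>set p. mean_demand I i) \<le> load_factor I * capacity I}"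

definition failure_cost :: "'w vrpsd_data \<Rightarrow> nat \<Rightarrow> real" where
  "failure_cost I i = penalty_F I + 2 * cost I 0 i"

definition preventive_cost :: "'w vrpsd_data \<Rightarrow> nat \<Rightarrow> nat \<Rightarrow> real" where
  "preventive_cost I i j = penalty_P I + cost I 0 i + cost I 0 j - cost I i j"

definition n_failures :: "'w vrpsd_data \<Rightarrow> nat \<Rightarrow> int \<Rightarrow> int" where
  "n_failures I s q = max \<lceil>(real s - real_of_int q) / real_of_int (capacity I)\<rceil> 0"

text \<open>
  The value functions \<open>F\<close> and \<open>H\<close> of the route at a customer depend on the part of the route that
  remains to be visited, which is passed as a list: \<open>restock_F I i js q\<close> is the cost-to-go after
  serving \<open>i\<close> with residual load \<open>q\<close> and customers \<open>js\<close> still to be visited, and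
  \<open>restock_H I j js q\<close> is the cost-to-go on arriving at \<open>j\<close> with load \<open>q\<close> and \<open>js\<close> to be visited
  after \<open>j\<close>. Supports may be infinite, hence \<open>infsum\<close>, which is \<open>0\<close> on non-summable families;
  for loads in \<open>{0..capacity I}\<close>, the integrability of the demands makes the families summable.
\<close>

function restock_F :: "'w vrpsd_data \<Rightarrow> nat \<Rightarrow> nat list \<Rightarrow> int \<Rightarrow> real"
  and restock_H :: "'w vrpsd_data \<Rightarrow> nat \<Rightarrow> nat list \<Rightarrow> int \<Rightarrow> real" where
  "restock_F I i [] q = 0"
| "restock_F I i (j # js) q =
     min (restock_H I j js q) (preventive_cost I i j + restock_H I j js (capacity I))"
| "restock_H I j js q =
     (\<Sum>\<^sub>\<infinity>s\<in>demand_support I j.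
        (failure_cost I j * n_failures I s q
          + restock_F I j js (n_failures I s q * capacity I + q - int s))
        * demand_prob I j s)"
  by pat_completeness auto
termination
  by (relation "Wellfounded.measure (case_sum (\<lambda>(_, _, js, _). 2 * length js) (\<lambda>(_, _, js, _). 2 * length js + 1))")
    auto

definition OR_recourse_directed :: "'w vrpsd_data \<Rightarrow> nat list \<Rightarrow> real" where
  "OR_recourse_directed I p = restock_F I 0 p (capacity I)"

definition OR_recourse :: "'w vrpsd_data \<Rightarrow> nat list \<Rightarrow> real" where
  "OR_recourse I p = min (OR_recourse_directed I p) (OR_recourse_directed I (rev p))"

end

(*
  Restocking at the depot right after p1 serves the rest of p1 @ p2 exactly like the route of p2
  alone, starting with a full vehicle. Every other continuation is at least as expensive, because
  the value functions F and H are antitone in the load: a vehicle with a smaller load either has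
  the same number of failures and a smaller residual load, or at least one more failure, and by the
  triangle inequality the cost of that failure covers the preventive return that brings the load
  back to the capacity. Hence appending p2 raises F by at least the full-load cost of p2, and
  reversing the concatenation gives the claim for the other orientation.
*)
theory Submission
  imports Defs
begin

context vrpsd
begin

section \<open>Signs and comparison of the costs\<close>

lemma depot_in_nodes [simp]: "0 \<in> nodes I"
  by (simp add: nodes_def)

lemma customer_in_nodes: "i \<in> customers I \<Longrightarrow> i \<in> nodes I"
  by (simp add: nodes_def)

lemma penalty_F_nonneg: "0 \<le> penalty_F I"
  using penalty_P_nonneg penalty_P_le_F by linarith

lemma failure_cost_nonneg: "i \<in> nodes I \<Longrightarrow> 0 \<le> failure_cost I i"
  using penalty_F_nonneg cost_nonneg[of 0 i] by (simp add: failure_cost_def)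

lemma preventive_cost_nonneg:
  assumes "i \<in> nodes I" "j \<in> nodes I"
  shows "0 \<le> preventive_cost I i j"
  using assms penalty_P_nonneg cost_triangle[of i 0 j] cost_sym[of i 0]
  by (simp add: preventive_cost_def)

text \<open>The triangle inequality bounds \<open>cost I 0 j - cost I i j\<close> by
  \<open>cost I 0 i\<close>, so one failure at \<open>i\<close> pays for a preventive return right
  after \<open>i\<close>.\<close>

lemma preventive_cost_le_failure_cost:
  assumes "i \<in> nodes I" "j \<in> nodes I"
  shows "preventive_cost I i j \<le> failure_cost I i"
  using assms penalty_P_le_F cost_triangle[of 0 i j]
  by (simp add: preventive_cost_def failure_cost_def)

section \<open>Failure counts and residual loads\<close>

lemma n_failures_nonneg: "0 \<le> n_failures I s q"
  by (simp add: n_failures_def)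

lemma n_failures_antimono:
  assumes "q \<le> q'"
  shows "n_failures I s q' \<le> n_failures I s q"
  unfolding n_failures_def using assms capacity_pos
  by (intro max.mono ceiling_mono divide_right_mono) auto

text \<open>The capacity is a positive integer, hence at least 1. This linear bound in
  \<open>s\<close> reduces summability of the failure costs to finiteness of the mean
  demand.\<close>

lemma n_failures_le:
  assumes "0 \<le> q"
  shows "n_failures I s q \<le> int s"
proof -
  have "(real s - real_of_int q) / real_of_int (capacity I) \<le> real s / real_of_int (capacity I)"
    using assms capacity_pos by (intro divide_right_mono) auto
  also have "\<dots> \<le> real s / 1"
    using capacity_pos by (intro divide_left_mono) auto
  finally show ?thesis
    by (simp add: n_failures_def ceiling_le_iff)
qed

text \<open>With \<open>x = (s - q) / capacity I\<close>, the residual load is \<open>q - s\<close>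
  if \<open>s\<close> is at most \<open>q\<close>, and otherwise the capacity times the gap between
  \<open>x\<close> and its ceiling. Loads thus stay in a finite integer range.\<close>

lemma residual_load_bounds:
  assumes "0 \<le> q" "q \<le> capacity I"
  shows "n_failures I s q * capacity I + q - int s \<in> {0..capacity I}"
proof -
  define x where "x = (real s - real_of_int q) / real_of_int (capacity I)"
  have x: "x * real_of_int (capacity I) = real s - real_of_int q"
    using capacity_pos by (simp add: x_def)
  show ?thesis
  proof (cases "int s \<le> q")
    case True
    then have "x \<le> 0"
      using capacity_pos by (simp add: x_def divide_nonpos_pos)
    then have "n_failures I s q = 0"
      by (simp add: n_failures_def x_def ceiling_le_iff)
    with True assms show ?thesis by simp
  next
    case False
    then have "0 \<le> x"
      using capacity_pos by (simp add: x_def)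
    then have n: "n_failures I s q = \<lceil>x\<rceil>"
      by (simp add: n_failures_def x_def)
    have "x * real_of_int (capacity I) \<le> \<lceil>x\<rceil> * real_of_int (capacity I)"
      using capacity_pos by (intro mult_right_mono) auto
    then have "real_of_int (int s - q) \<le> real_of_int (\<lceil>x\<rceil> * capacity I)"
      unfolding x by simp
    then have lower: "int s - q \<le> \<lceil>x\<rceil> * capacity I"
      by linarith
    have "\<lceil>x\<rceil> * real_of_int (capacity I) \<le> (x + 1) * real_of_int (capacity I)"
      using capacity_pos by (intro mult_right_mono) linarith+
    then have "real_of_int (\<lceil>x\<rceil> * capacity I) \<le> real_of_int (int s - q + capacity I)"
      using x by (simp add: distrib_right)
    then have "\<lceil>x\<rceil> * capacity I \<le> int s - q + capacity I"
      by linarith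
    with lower n show ?thesis by simp
  qed
qed

section \<open>Distribution and mean of the demands\<close>

lemma demand_measurable:
  assumes "i \<in> customers I"
  shows "demand I i \<in> measurable (prob_model I) (count_space UNIV)"
  using demand_indep assms by (auto simp: indep_vars_def)

lemma demand_event:
  assumes "i \<in> customers I"
  shows "{\<omega> \<in> space (prob_model I). demand I i \<omega> = s} \<in> events"
  using measurable_sets[OF demand_measurable[OF assms], of "{s}"]
  by (simp add: vimage_def Int_def conj_commute)

lemma demand_prob_nonneg: "0 \<le> demand_prob I i s"
  by (simp add: demand_prob_def)

lemma demand_prob_zero: "s \<notin> demand_support I i \<Longrightarrow> demand_prob I i s = 0"
  using demand_prob_nonneg[of i s] by (simp add: demand_support_def)

text \<open>The events that the demand equals \<open>s\<close> partition the sample space;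
  restricting to the support drops only zero terms.\<close>

lemma demand_prob_has_sum:
  assumes "i \<in> customers I"
  shows "(demand_prob I i has_sum 1) (demand_support I i)"
proof -
  define A where "A s = {\<omega> \<in> space (prob_model I). demand I i \<omega> = s}" for s
  have "(\<lambda>s. prob (A s)) sums prob (\<Union>s. A s)"
    using assms demand_event
    by (intro finite_measure_UNION) (auto simp: A_def disjoint_family_on_def)
  moreover have "(\<Union>s. A s) = space (prob_model I)"
    by (auto simp: A_def)
  ultimately have "demand_prob I i sums 1"
    by (simp add: demand_prob_def[abs_def] A_def prob_space)
  then have "(demand_prob I i has_sum 1) UNIV"
    by (intro sums_nonneg_imp_has_sum) (auto simp: demand_prob_nonneg)
  then show ?thesis
    by (subst has_sum_cong_neutral[where T = UNIV and g = "demand_prob I i"])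
      (auto simp: demand_prob_zero)
qed

text \<open>The terms are nonnegative, and each finite partial sum is the expectation of a function
  below the demand, so the mean bounds all of them.\<close>

lemma demand_mean_summable:
  assumes "i \<in> customers I"
  shows "(\<lambda>s. real s * demand_prob I i s) summable_on A"
proof (rule nonneg_bdd_above_summable_on)
  show "bdd_above (sum (\<lambda>s. real s * demand_prob I i s) ` {F. F \<subseteq> A \<and> finite F})"
  proof (rule bdd_aboveI2)
    fix F assume "F \<in> {F. F \<subseteq> A \<and> finite F}"
    then have F: "finite F" by simp
    define E where "E s = {\<omega> \<in> space (prob_model I). demand I i \<omega> = s}" for s
    have E: "E s \<in> events" for s
      using assms demand_event by (simp add: E_def)
    have int_E: "integrable (prob_model I) (\<lambda>\<omega>. real s * indicator (E s) \<omega>)" for s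
      using E by (intro integrable_mult_right) (simp add: emeasure_eq_measure)
    have "(\<Sum>s\<in>F. real s * demand_prob I i s)
        = (\<Sum>s\<in>F. expectation (\<lambda>\<omega>. real s * indicator (E s) \<omega>))"
      using E by (simp add: demand_prob_def E_def[symmetric])
    also have "\<dots> = expectation (\<lambda>\<omega>. \<Sum>s\<in>F. real s * indicator (E s) \<omega>)"
      using int_E by simp
    also have "\<dots> \<le> expectation (\<lambda>\<omega>. real (demand I i \<omega>))"
    proof (rule integral_mono)
      fix \<omega> assume "\<omega> \<in> space (prob_model I)"
      \<comment> \<open>At a given outcome only the indicator of the realized demand is
        nonzero.\<close>
      then have "(\<Sum>s\<in>F. real s * indicator (E s) \<omega>)
          = (\<Sum>s\<in>F. if s = demand I i \<omega> then real s else 0)"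
        by (intro sum.cong) (auto simp: E_def indicator_def)
      also have "\<dots> \<le> real (demand I i \<omega>)"
        using F by (simp add: sum.delta)
      finally show "(\<Sum>s\<in>F. real s * indicator (E s) \<omega>) \<le> real (demand I i \<omega>)" .
    qed (use int_E demand_integrable assms in auto)
    finally show "(\<Sum>s\<in>F. real s * demand_prob I i s) \<le> mean_demand I i"
      by (simp add: mean_demand_def)
  qed
qed (simp add: demand_prob_nonneg)

text \<open>Needed because \<open>infsum\<close> is \<open>0\<close> on non-summable families. The
  cost-to-go is an arbitrary \<open>g\<close>: it is evaluated only on the finite set of loads,
  where it is bounded, so no prior estimate of \<open>restock_F\<close> is required.\<close>

lemma restock_terms_summable:
  assumes j: "j \<in> customers I" and q: "0 \<le> q" "q \<le> capacity I"
  shows "(\<lambda>s. (failure_cost I j * n_failures I s q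
            + g (n_failures I s q * capacity I + q - int s)) * demand_prob I j s)
          summable_on demand_support I j"
proof -
  define B where "B = Max ((\<lambda>r. \<bar>g r\<bar>) ` {0..capacity I})"
  have B: "\<bar>g r\<bar> \<le> B" if "r \<in> {0..capacity I}" for r
    using that by (auto simp: B_def)
  have c: "0 \<le> failure_cost I j"
    using j failure_cost_nonneg customer_in_nodes by blast
  have "(\<lambda>s. failure_cost I j * (real s * demand_prob I j s) + B * demand_prob I j s)
      summable_on demand_support I j"
    using demand_mean_summable[OF j] demand_prob_has_sum[OF j]
    by (intro summable_on_add summable_on_cmult_right) (auto simp: summable_on_def)
  then have dom: "(\<lambda>s. (failure_cost I j * real s + B) * demand_prob I j s)
      summable_on demand_support I j"
    by (simp add: algebra_simps)
  have "(\<lambda>s. norm ((failure_cost I j * n_failures I s q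
      + g (n_failures I s q * capacity I + q - int s)) * demand_prob I j s))
      summable_on demand_support I j"
  proof (rule summable_on_comparison_test[OF dom])
    fix s
    have "0 \<le> real_of_int (n_failures I s q)" "real_of_int (n_failures I s q) \<le> real s"
      using n_failures_nonneg[of s q] n_failures_le[OF q(1), of s] by linarith+
    then have "0 \<le> failure_cost I j * n_failures I s q"
      "failure_cost I j * n_failures I s q \<le> failure_cost I j * real s"
      using c by (simp_all add: mult_left_mono)
    then have "\<bar>failure_cost I j * n_failures I s q
        + g (n_failures I s q * capacity I + q - int s)\<bar> \<le> failure_cost I j * real s + B"
      using B[OF residual_load_bounds[OF q], of s] by linarith
    from mult_right_mono[OF this demand_prob_nonneg[of j s]]
    show "norm ((failure_cost I j * n_failures I s q
        + g (n_failures I s q * capacity I + q - int s)) * demand_prob I j s)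
        \<le> (failure_cost I j * real s + B) * demand_prob I j s"
      using demand_prob_nonneg[of j s] by (simp only: real_norm_def abs_mult abs_of_nonneg)
  qed (rule norm_ge_zero)
  then show ?thesis
    by (rule abs_summable_summable)
qed

section \<open>Monotonicity of the value functions in the load\<close>

declare restock_H.simps [simp del]

text \<open>The comparison is made for each demand \<open>s\<close> separately. The assumptions
  \<open>mono\<close> and \<open>bound\<close> are what the induction on the remaining route
  supplies.\<close>

lemma restock_H_antimono:
  assumes j: "j \<in> customers I" and q: "0 \<le> q" "q \<le> q'" "q' \<le> capacity I"
    and mono: "\<And>r r'. \<lbrakk>0 \<le> r; r \<le> r'; r' \<le> capacity I\<rbrakk> \<Longrightarrow> restock_F I j js r' \<le> restock_F I j js r"
    and bound: "\<And>r r'. \<lbrakk>r \<in> {0..capacity I}; r' \<in> {0..capacity I}\<rbrakk> \<Longrightarrow>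
      restock_F I j js r' \<le> failure_cost I j + restock_F I j js r"
  shows "restock_H I j js q' \<le> restock_H I j js q"
  unfolding restock_H.simps
proof (rule infsum_mono)
  fix s
  let ?n = "n_failures I s q" and ?n' = "n_failures I s q'"
  let ?r = "?n * capacity I + q - int s" and ?r' = "?n' * capacity I + q' - int s"
  have r: "?r \<in> {0..capacity I}" "?r' \<in> {0..capacity I}"
    using q by (auto intro!: residual_load_bounds simp del: atLeastAtMost_iff)
  have "failure_cost I j * ?n' + restock_F I j js ?r'
      \<le> failure_cost I j * ?n + restock_F I j js ?r"
  proof (cases "?n' = ?n")
    case True
    then show ?thesis
      using mono[of ?r ?r'] r q by simp
  next
    case False
    \<comment> \<open>Differing integer counts differ by at least one; the extra
      \<open>failure_cost I j\<close> is exactly the slack in \<open>bound\<close>.\<close>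
    with n_failures_antimono[OF q(2), of s] have "real_of_int ?n' + 1 \<le> real_of_int ?n"
      by linarith
    then have "failure_cost I j * (real_of_int ?n' + 1) \<le> failure_cost I j * ?n"
      using failure_cost_nonneg customer_in_nodes[OF j] by (intro mult_left_mono) auto
    then show ?thesis
      using bound[OF r] by (simp add: distrib_left)
  qed
  then show "(failure_cost I j * ?n' + restock_F I j js ?r') * demand_prob I j s
      \<le> (failure_cost I j * ?n + restock_F I j js ?r) * demand_prob I j s"
    by (intro mult_right_mono demand_prob_nonneg)
qed (use j q in \<open>auto intro!: restock_terms_summable\<close>)

text \<open>Both claims go through one induction, since \<open>restock_H_antimono\<close> at the
  next customer consumes both.\<close>

lemma restock_F_antimono_and_bound:
  assumes "i \<in> nodes I" "set js \<subseteq> customers I"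
  shows "(\<forall>q q'. 0 \<le> q \<longrightarrow> q \<le> q' \<longrightarrow> q' \<le> capacity I \<longrightarrow>
      restock_F I i js q' \<le> restock_F I i js q) \<and>
    (\<forall>q\<in>{0..capacity I}. \<forall>q'\<in>{0..capacity I}.
      restock_F I i js q' \<le> failure_cost I i + restock_F I i js q)"
  using assms
proof (induction js arbitrary: i)
  case Nil
  then show ?case by (simp add: failure_cost_nonneg)
next
  case (Cons j js)
  then have j: "j \<in> customers I" "j \<in> nodes I"
    using customer_in_nodes by auto
  have H: "restock_H I j js q' \<le> restock_H I j js q" if "0 \<le> q" "q \<le> q'" "q' \<le> capacity I" for q q'
    using Cons.IH[of j] Cons.prems j that by (intro restock_H_antimono) auto
  show ?case
  proof (intro conjI allI impI ballI)
    fix q q' assume "0 \<le> q" "q \<le> q'" "q' \<le> capacity I"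
    from H[OF this] show "restock_F I i (j # js) q' \<le> restock_F I i (j # js) q"
      by auto
  next
    fix q q' assume "q \<in> {0..capacity I}" "q' \<in> {0..capacity I}"
    \<comment> \<open>Restocking bounds the left side by \<open>preventive_cost I i j\<close> plus
      the full-load value of \<open>restock_H\<close>; both options at \<open>q\<close> cost at
      least that full-load value.\<close>
    then show "restock_F I i (j # js) q' \<le> failure_cost I i + restock_F I i (j # js) q"
      using H[of q "capacity I"] preventive_cost_nonneg[OF Cons.prems(1) j(2)]
        preventive_cost_le_failure_cost[OF Cons.prems(1) j(2)]
      by auto
  qed
qed

section \<open>Appending a second route\<close>

lemma restock_F_depot_le:
  assumes i: "i \<in> nodes I" and p: "set p \<subseteq> customers I" and q: "0 \<le> q" "q \<le> capacity I"
  shows "restock_F I 0 p (capacity I) \<le> restock_F I i p q"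
proof (cases p)
  case (Cons k ks)
  then have k: "k \<in> customers I" "k \<in> nodes I"
    using p customer_in_nodes by auto
  have "restock_H I k ks (capacity I) \<le> restock_H I k ks q"
    using restock_F_antimono_and_bound[of k ks] k p Cons q
    by (intro restock_H_antimono) auto
  then show ?thesis
    using preventive_cost_nonneg[OF i k(2)] by (auto simp: Cons)
qed simp

text \<open>The probabilities sum to 1, so a constant gap \<open>C\<close> between the costs-to-go
  survives averaging over the demand.\<close>

lemma restock_H_add_const_le:
  assumes j: "j \<in> customers I" and q: "0 \<le> q" "q \<le> capacity I"
    and le: "\<And>r. r \<in> {0..capacity I} \<Longrightarrow> restock_F I j js r + C \<le> restock_F I j js' r"
  shows "restock_H I j js q + C \<le> restock_H I j js' q"
proof -
  let ?n = "\<lambda>s. n_failures I s q"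
  let ?t = "\<lambda>ks s. (failure_cost I j * ?n s
    + restock_F I j ks (?n s * capacity I + q - int s)) * demand_prob I j s"
  have "((\<lambda>s. ?t js s + C * demand_prob I j s) has_sum restock_H I j js q + C * 1)
      (demand_support I j)"
    unfolding restock_H.simps using j q
    by (intro has_sum_add has_sum_infsum has_sum_cmult_right restock_terms_summable
        demand_prob_has_sum)
  moreover have "(?t js' has_sum restock_H I j js' q) (demand_support I j)"
    unfolding restock_H.simps using j q
    by (intro has_sum_infsum restock_terms_summable)
  moreover have "?t js s + C * demand_prob I j s \<le> ?t js' s" for s
    using mult_right_mono[OF le[OF residual_load_bounds[OF q]] demand_prob_nonneg[of j s]]
    by (simp add: algebra_simps)
  ultimately have "restock_H I j js q + C * 1 \<le> restock_H I j js' q"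
    by (rule has_sum_mono)
  then show ?thesis by simp
qed

text \<open>Induction on \<open>js\<close>: \<open>restock_F_depot_le\<close> is the base case, and
  the full-load cost of \<open>p\<close> is the constant carried back through each customer.\<close>

lemma restock_F_append_ge:
  assumes "i \<in> nodes I" "set js \<subseteq> customers I" "set p \<subseteq> customers I" "q \<in> {0..capacity I}"
  shows "restock_F I i js q + restock_F I 0 p (capacity I) \<le> restock_F I i (js @ p) q"
  using assms
proof (induction js arbitrary: i q)
  case Nil
  then show ?case by (simp add: restock_F_depot_le)
next
  case (Cons j js)
  then have j: "j \<in> customers I" "j \<in> nodes I"
    using customer_in_nodes by auto
  have "restock_H I j js r + restock_F I 0 p (capacity I) \<le> restock_H I j (js @ p) r"
    if "r \<in> {0..capacity I}" for r
    using Cons.IH[of j] Cons.prems j that by (intro restock_H_add_const_le) auto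
  \<comment> \<open>The load \<open>q\<close> serves the option of going on, the full load that of
    restocking; both arms of the minimum gain the same constant.\<close>
  from this[of q] this[of "capacity I"] show ?case
    using Cons.prems capacity_pos by auto
qed

lemma OR_recourse_directed_append_ge:
  assumes "set p1 \<subseteq> customers I" "set p2 \<subseteq> customers I"
  shows "OR_recourse_directed I p1 + OR_recourse_directed I p2 \<le> OR_recourse_directed I (p1 @ p2)"
  using restock_F_append_ge[of 0 p1 p2 "capacity I"] assms capacity_pos
  by (simp add: OR_recourse_directed_def)

end

theorem theorem3:
  fixes I :: "'w vrpsd_data" and p1 p2 :: "nat list"
  assumes "vrpsd I"
    and "p1 \<in> paths I" and "p2 \<in> paths I" and "p1 @ p2 \<in> paths I"
  shows "OR_recourse I (p1 @ p2) \<ge> OR_recourse I p1 + OR_recourse I p2"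
proof -
  interpret vrpsd I by fact
  have "set p1 \<subseteq> customers I" "set p2 \<subseteq> customers I"
    using assms by (auto simp: paths_def)
  \<comment> \<open>Whichever orientation attains the minimum, it splits into directed costs of the
    two parts, each at least the corresponding \<open>OR_recourse\<close>.\<close>
  then show ?thesis
    using OR_recourse_directed_append_ge[of p1 p2]
      OR_recourse_directed_append_ge[of "rev p2" "rev p1"]
    by (auto simp: OR_recourse_def)
qed

end
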